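(* Let $\tau \in (0,1)$ and let $\mathbf P$ be a probability law on $\mathbb R$ (no integrability condition is assumed), with right-continuous distribution function $F(x) = \mathbf P((-\infty,x])$. Let $\Phi:\mathbb R\to\mathbb R$ be defined by $$\Phi(q) = \int_{\mathbb R} \bigl(\rho_\tau(x-q) - \rho_\tau(x)\bigr)\, d\mathbf P(x).$$ Then, for every $q\in\mathbb R$, $$\Phi(q) = \begin{cases} -\tau q + \int_{(0,q]} F(x)\,dx & \text{if } q \ge 0,\\ -\tau q - \int_{(q,0]} F(x)\,dx & \text{if } q<0,\end{cases}$$ that is, $\Phi(q) = \mathbf F(q) - \tau q$, where $\mathbf F$ is the primitive of $F$ vanishing at $0$. The function $\Phi$ is convex and inf-compact. A real number $\bar q$ is a $\tau$-quantile of $\mathbf P$ if and only if it minimizes $\Phi$ on $\mathbb R$.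
   Context: For $\tau\in(0,1)$, $\rho_\tau:\mathbb R\to\mathbb R$ is defined by $\rho_\tau(x) = \frac12|x| + (\tau-\frac12)x$, i.e. $\rho_\tau(x) = (\tau-1)x$ if $x\le 0$ and $\rho_\tau(x)=\tau x$ if $x\ge 0$. For each $q$, the function $x\mapsto \rho_\tau(x-q)-\rho_\tau(x)$ is bounded on $\mathbb R$, so the integral defining $\Phi(q)$ is well defined and finite. The primitive of $F$ vanishing at $0$ is $\mathbf F(x) = \int_0^x F(u)\,du$ if $x\ge 0$ and $\mathbf F(x) = -\int_x^0 F(u)\,du$ if $x<0$. A real number $\bar q$ is a $\tau$-quantile of $\mathbf P$ if $\mathbf P((-\infty,\bar q)) \le \tau \le \mathbf P((-\infty,\bar q])$ (equivalently, $\mathbf P((-\infty,\bar q])\ge\tau$ and $\mathbf P([\bar q,+\infty))\ge 1-\tau$). A function $\Phi:\mathbb R\to\mathbb R$ is inf-compact if for every $r\in\mathbb R$ the sublevel set $\{q\in\mathbb R : \Phi(q)\le r\}$ is compact. *)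

theory Defs
  imports "HOL-Probability.Probability"
begin

definition quantile_loss :: "real \<Rightarrow> real \<Rightarrow> real" where
  "quantile_loss \<tau> x = \<bar>x\<bar> / 2 + (\<tau> - 1 / 2) * x"

lemma quantile_loss_nonpos: "x \<le> 0 \<Longrightarrow> quantile_loss \<tau> x = (\<tau> - 1) * x"
  and quantile_loss_nonneg: "x \<ge> 0 \<Longrightarrow> quantile_loss \<tau> x = \<tau> * x"
  by (simp_all add: quantile_loss_def algebra_simps)

text \<open>Subtracting the loss at \<open>x\<close> makes the integrand bounded in \<open>x\<close>, so that no moment of the
  law is needed.\<close>

definition quantile_objective :: "real \<Rightarrow> real measure \<Rightarrow> real \<Rightarrow> real" where
  "quantile_objective \<tau> P q = (LINT x|P. quantile_loss \<tau> (x - q) - quantile_loss \<tau> x)"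

lemma quantile_loss_diff_bound:
  assumes "0 < \<tau>" "\<tau> < 1"
  shows "\<bar>quantile_loss \<tau> (x - q) - quantile_loss \<tau> x\<bar> \<le> \<bar>q\<bar>"
proof -
  have eq: "quantile_loss \<tau> (x - q) - quantile_loss \<tau> x = (\<bar>x - q\<bar> - \<bar>x\<bar>) / 2 - (\<tau> - 1 / 2) * q"
    by (simp add: quantile_loss_def field_simps)
  have "\<bar>(\<tau> - 1 / 2) * q\<bar> \<le> 1 / 2 * \<bar>q\<bar>"
    unfolding abs_mult by (rule mult_right_mono) (use assms in linarith, simp)
  moreover have "\<bar>(\<bar>x - q\<bar> - \<bar>x\<bar>) / 2\<bar> \<le> 1 / 2 * \<bar>q\<bar>"
    using abs_triangle_ineq3[of "x - q" x] by simp
  ultimately show ?thesis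
    unfolding eq using abs_triangle_ineq4[of "(\<bar>x - q\<bar> - \<bar>x\<bar>) / 2" "(\<tau> - 1 / 2) * q"] by simp
qed

lemma integrable_quantile_objective:
  assumes "real_distribution P" "0 < \<tau>" "\<tau> < 1"
  shows "integrable P (\<lambda>x. quantile_loss \<tau> (x - q) - quantile_loss \<tau> x)"
proof -
  interpret real_distribution P by fact
  show ?thesis
  proof (rule integrable_const_bound[where B = "\<bar>q\<bar>"])
    show "AE x in P. norm (quantile_loss \<tau> (x - q) - quantile_loss \<tau> x) \<le> \<bar>q\<bar>"
      using quantile_loss_diff_bound[OF assms(2,3)] by simp
    show "(\<lambda>x. quantile_loss \<tau> (x - q) - quantile_loss \<tau> x) \<in> borel_measurable P"
      unfolding quantile_loss_def by measurable
  qed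
qed

definition primitive_at_0 :: "(real \<Rightarrow> real) \<Rightarrow> real \<Rightarrow> real" where
  "primitive_at_0 F x =
    (if x \<ge> 0 then (LINT u:{0..x}|lborel. F u) else - (LINT u:{x..0}|lborel. F u))"

definition is_quantile :: "real \<Rightarrow> real measure \<Rightarrow> real \<Rightarrow> bool" where
  "is_quantile \<tau> P q \<longleftrightarrow> measure P {..<q} \<le> \<tau> \<and> \<tau> \<le> measure P {..q}"

definition inf_compact :: "(real \<Rightarrow> real) \<Rightarrow> bool" where
  "inf_compact f \<longleftrightarrow> (\<forall>r. compact {q. f q \<le> r})"

end

theory Submission
  imports Defs
begin

text \<open>The function \<open>q \<mapsto> \<rho>\<^sub>\<tau> (x - q)\<close> is convex with subgradients \<open>1[x \<le> q] - \<tau>\<close> and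
  \<open>1[x < q] - \<tau>\<close> at \<open>q\<close>. Integrating against the law shows that both \<open>F(q) - \<tau>\<close> and \<open>F(q-) - \<tau>\<close>
  are subgradients of \<open>\<Phi>\<close> at \<open>q\<close>; convexity, inf-compactness and the description of the minimizers all follow
  from this. The formula for \<open>\<Phi>\<close> comes from writing the increment of the loss as
  \<open>\<integral> 1[x \<le> u] du - \<tau> (b - a)\<close> over \<open>u \<in> (a, b]\<close> and applying Fubini.\<close>

text \<open>The integral is the length of the part of \<open>{a<..b}\<close> at or above
  \<open>x\<close>, namely \<open>max 0 (b - max a x)\<close>. The integrand is kept as a product of
  indicators so that integrating over \<open>x\<close> first turns the second factor into
  \<open>cdf M u\<close>.\<close>

lemma quantile_loss_diff_eq:
  assumes "a \<le> b"
  shows "quantile_loss \<tau> (x - b) - quantile_loss \<tau> (x - a) =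
    (LINT u|lborel. indicator {a<..b} u * indicator {..u} x) - \<tau> * (b - a)"
proof -
  have "(LINT u|lborel. indicator {a<..b} u * indicator {..u} x :: real) =
      (LINT u|lborel. indicator ({a<..b} \<inter> {x..}) u)"
    by (intro Bochner_Integration.integral_cong) (auto simp: indicator_def)
  also have "\<dots> = measure lborel ({a<..b} \<inter> {x..})"
    by simp
  also have "\<dots> = max 0 (b - max a x)"
  proof (cases "x \<le> a")
    case True
    then have "{a<..b} \<inter> {x..} = {a<..b}" by auto
    with True assms show ?thesis by simp
  next
    case False
    then have "{a<..b} \<inter> {x..} = {x..b}" by auto
    with False assms show ?thesis by (cases "x \<le> b") (simp_all add: max_def)
  qed
  finally show ?thesis
    using assms by (auto simp: quantile_loss_def max_def abs_if field_simps)
qed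

text \<open>As a function of \<open>q\<close>, the loss has slope \<open>- \<tau>\<close> before the
  kink at \<open>x\<close> and \<open>1 - \<tau>\<close> after it. The two versions differ only at
  \<open>q = x\<close>, where they take the right and the left slope.\<close>

lemma quantile_loss_subgradient:
  shows "quantile_loss \<tau> (x - y) - quantile_loss \<tau> (x - q) \<ge> (indicator {..q} x - \<tau>) * (y - q)"
    and "quantile_loss \<tau> (x - y) - quantile_loss \<tau> (x - q) \<ge> (indicator {..<q} x - \<tau>) * (y - q)"
  by (auto simp: quantile_loss_def indicator_def abs_if field_simps)

lemma quantile_objective_0 [simp]: "quantile_objective \<tau> P 0 = 0"
  by (simp add: quantile_objective_def)

context real_distribution
begin

text \<open>The compensating term in \<open>x\<close> cancels in an increment of the objective. The
  integral cannot be split further, since the loss alone may fail to be integrable.\<close>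

lemma quantile_objective_diff:
  assumes "0 < \<tau>" "\<tau> < 1"
  shows "integrable M (\<lambda>x. quantile_loss \<tau> (x - y) - quantile_loss \<tau> (x - q))"
    and "quantile_objective \<tau> M y - quantile_objective \<tau> M q =
      (LINT x|M. quantile_loss \<tau> (x - y) - quantile_loss \<tau> (x - q))"
proof -
  note int = integrable_quantile_objective[OF real_distribution_axioms assms]
  show "integrable M (\<lambda>x. quantile_loss \<tau> (x - y) - quantile_loss \<tau> (x - q))"
    using Bochner_Integration.integrable_diff[OF int[of y] int[of q]] by simp
  show "quantile_objective \<tau> M y - quantile_objective \<tau> M q =
      (LINT x|M. quantile_loss \<tau> (x - y) - quantile_loss \<tau> (x - q))"
    unfolding quantile_objective_def
    by (subst Bochner_Integration.integral_diff[symmetric, OF int int]) simp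
qed

lemma quantile_objective_increment:
  assumes "0 < \<tau>" "\<tau> < 1" "a \<le> b"
  shows "quantile_objective \<tau> M b - quantile_objective \<tau> M a =
    (LINT u:{a<..b}|lborel. cdf M u) - \<tau> * (b - a)"
proof -
  interpret pair: pair_sigma_finite M lborel ..
  let ?f = "\<lambda>x u. indicator {a<..b} u * indicator {..u} x :: real"
  have meas: "case_prod ?f \<in> borel_measurable (M \<Otimes>\<^sub>M lborel)"
  proof -
    have "case_prod ?f = (\<lambda>p. if a < snd p \<and> snd p \<le> b \<and> fst p \<le> snd p then 1 else 0)"
      by (auto simp: indicator_def fun_eq_iff)
    then show ?thesis by simp
  qed
  have int: "integrable (M \<Otimes>\<^sub>M lborel) (case_prod ?f)"
  \<comment> \<open>The integrand is dominated by the indicator of the strip over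
    \<open>{a<..b}\<close>, whose product measure is \<open>b - a\<close>.\<close>
  proof (rule Bochner_Integration.integrable_bound[OF _ meas])
    have "emeasure (M \<Otimes>\<^sub>M lborel) (space M \<times> {a<..b}) < \<infinity>"
      using assms(3) by (subst lborel.emeasure_pair_measure_Times) (auto simp: emeasure_eq_measure simp flip: ennreal_mult)
    then show "integrable (M \<Otimes>\<^sub>M lborel) (indicator (space M \<times> {a<..b}) :: _ \<Rightarrow> real)"
      by (subst integrable_indicator_iff) (auto simp: space_pair_measure)
  qed (auto simp: indicator_def)
  have "quantile_objective \<tau> M b - quantile_objective \<tau> M a =
      (LINT x|M. (LINT u|lborel. ?f x u) - \<tau> * (b - a))"
    using assms by (simp add: quantile_objective_diff(2) quantile_loss_diff_eq)
  also have "\<dots> = (LINT x|M. LINT u|lborel. ?f x u) - \<tau> * (b - a)"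
    using pair.integrable_fst'[OF int] by (simp add: prob_space[unfolded space_eq_univ])
  also have "(LINT x|M. LINT u|lborel. ?f x u) = (LINT u|lborel. LINT x|M. ?f x u)"
    by (rule pair.Fubini_integral[symmetric, OF int])
  also have "\<dots> = (LINT u:{a<..b}|lborel. cdf M u)"
    by (simp add: set_lebesgue_integral_def cdf_def)
  finally show ?thesis .
qed

lemma quantile_objective_subgradient:
  assumes "0 < \<tau>" "\<tau> < 1"
  shows "quantile_objective \<tau> M y \<ge> quantile_objective \<tau> M q + (cdf M q - \<tau>) * (y - q)"
    and "quantile_objective \<tau> M y \<ge> quantile_objective \<tau> M q + (measure M {..<q} - \<tau>) * (y - q)"
proof -
  \<comment> \<open>Stated for a general Borel set \<open>A\<close>, so that \<open>{..q}\<close>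
    and \<open>{..<q}\<close> are treated by one integration.\<close>
  have *: "quantile_objective \<tau> M y \<ge> quantile_objective \<tau> M q + (measure M A - \<tau>) * (y - q)"
    if A: "A \<in> sets borel"
      and le: "\<And>x. (indicator A x - \<tau>) * (y - q) \<le> quantile_loss \<tau> (x - y) - quantile_loss \<tau> (x - q)"
    for A
  proof -
    have int: "integrable M (\<lambda>x. (indicator A x - \<tau>) * (y - q))"
      using A by (intro Bochner_Integration.integrable_mult_left Bochner_Integration.integrable_diff)
        (auto simp: emeasure_eq_measure)
    have "(LINT x|M. (indicator A x - \<tau>) * (y - q)) \<le>
        (LINT x|M. quantile_loss \<tau> (x - y) - quantile_loss \<tau> (x - q))"
      using int quantile_objective_diff(1)[OF assms] le by (rule integral_mono)
    moreover have "(LINT x|M. (indicator A x - \<tau>) * (y - q)) = (measure M A - \<tau>) * (y - q)"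
      using A by (subst Bochner_Integration.integral_mult_left_zero,
          subst Bochner_Integration.integral_diff) (auto simp: prob_space[unfolded space_eq_univ] emeasure_eq_measure)
    ultimately show ?thesis
      using quantile_objective_diff(2)[OF assms, of y q] by linarith
  qed
  show "quantile_objective \<tau> M y \<ge> quantile_objective \<tau> M q + (cdf M q - \<tau>) * (y - q)"
    unfolding cdf_def by (rule *) (auto intro: quantile_loss_subgradient)
  show "quantile_objective \<tau> M y \<ge> quantile_objective \<tau> M q + (measure M {..<q} - \<tau>) * (y - q)"
    by (rule *) (auto intro: quantile_loss_subgradient)
qed

lemma convex_on_quantile_objective:
  assumes "0 < \<tau>" "\<tau> < 1"
  shows "convex_on UNIV (quantile_objective \<tau> M)"
proof (rule convex_onI)
  fix t x y :: real
  assume t: "0 < t" "t < 1"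
  define z where "z = (1 - t) * x + t * y"
  let ?\<Phi> = "quantile_objective \<tau> M" and ?g = "cdf M z - \<tau>"
  \<comment> \<open>Average the supporting line at \<open>z\<close> over \<open>x\<close> and
    \<open>y\<close>; since \<open>z\<close> is their weighted mean, the slope terms cancel.\<close>
  have "(1 - t) * (?\<Phi> z + ?g * (x - z)) + t * (?\<Phi> z + ?g * (y - z)) \<le> (1 - t) * ?\<Phi> x + t * ?\<Phi> y"
    using t by (intro add_mono mult_left_mono quantile_objective_subgradient assms) auto
  also have "(1 - t) * (?\<Phi> z + ?g * (x - z)) + t * (?\<Phi> z + ?g * (y - z)) = ?\<Phi> z"
    unfolding z_def by (simp add: algebra_simps)
  finally show "?\<Phi> ((1 - t) *\<^sub>R x + t *\<^sub>R y) \<le> (1 - t) * ?\<Phi> x + t * ?\<Phi> y"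
    by (simp add: z_def)
qed auto

lemma inf_compact_quantile_objective:
  assumes "0 < \<tau>" "\<tau> < 1"
  shows "inf_compact (quantile_objective \<tau> M)"
  unfolding inf_compact_def
proof
  fix r
  let ?\<Phi> = "quantile_objective \<tau> M"
  \<comment> \<open>The limits 0 and 1 of the distribution function give a point \<open>a\<close>
    with negative subgradient and a point \<open>b\<close> with positive one. Their supporting lines
    force growth on both sides.\<close>
  have "\<forall>\<^sub>F x in at_bot. cdf M x < \<tau>"
    using order_tendstoD(2)[OF cdf_lim_at_bot assms(1)] .
  then obtain a where a: "cdf M a < \<tau>"
    by (auto simp: eventually_at_bot_linorder)
  have "\<forall>\<^sub>F x in at_top. \<tau> < cdf M x"
    using order_tendstoD(1)[OF cdf_lim_at_top_prob assms(2)] .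
  then obtain b where b: "\<tau> < cdf M b"
    by (auto simp: eventually_at_top_linorder)
  \<comment> \<open>The endpoints are where the supporting lines at \<open>a\<close> and
    \<open>b\<close> reach the level \<open>r\<close>.\<close>
  have "{q. ?\<Phi> q \<le> r} \<subseteq> {a - (r - ?\<Phi> a) / (\<tau> - cdf M a) .. b + (r - ?\<Phi> b) / (cdf M b - \<tau>)}"
  proof
    fix q assume "q \<in> {q. ?\<Phi> q \<le> r}"
    then have "(\<tau> - cdf M a) * (a - q) \<le> r - ?\<Phi> a" "(cdf M b - \<tau>) * (q - b) \<le> r - ?\<Phi> b"
      using quantile_objective_subgradient(1)[OF assms, of a q]
        quantile_objective_subgradient(1)[OF assms, of b q] by (auto simp: algebra_simps)
    then have "a - q \<le> (r - ?\<Phi> a) / (\<tau> - cdf M a)" "q - b \<le> (r - ?\<Phi> b) / (cdf M b - \<tau>)"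
      using a b by (simp_all add: pos_le_divide_eq mult.commute)
    then show "q \<in> {a - (r - ?\<Phi> a) / (\<tau> - cdf M a) .. b + (r - ?\<Phi> b) / (cdf M b - \<tau>)}"
      by simp
  qed
  then have "bounded {q. ?\<Phi> q \<le> r}"
    by (rule bounded_subset[OF bounded_closed_interval])
  moreover have "continuous_on UNIV ?\<Phi>"
    by (rule convex_on_continuous[OF open_UNIV convex_on_quantile_objective[OF assms]])
  then have "closed {q. ?\<Phi> q \<le> r}"
    by (intro closed_Collect_le) auto
  ultimately show "compact {q. ?\<Phi> q \<le> r}"
    by (simp add: compact_eq_bounded_closed)
qed

lemma is_quantile_iff_minimizer:
  assumes "0 < \<tau>" "\<tau> < 1"
  shows "is_quantile \<tau> M q \<longleftrightarrow> (\<forall>q'. quantile_objective \<tau> M q \<le> quantile_objective \<tau> M q')"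
proof
  note sub = quantile_objective_subgradient[OF assms]
  assume q: "is_quantile \<tau> M q"
  show "\<forall>q'. quantile_objective \<tau> M q \<le> quantile_objective \<tau> M q'"
  proof
    fix q'
    show "quantile_objective \<tau> M q \<le> quantile_objective \<tau> M q'"
    \<comment> \<open>To the right of \<open>q\<close> the subgradient from \<open>{..q}\<close> is
      nonnegative; to the left the one from \<open>{..<q}\<close> is nonpositive.\<close>
    proof (cases "q \<le> q'")
      case True
      with q have "0 \<le> (cdf M q - \<tau>) * (q' - q)"
        by (auto simp: is_quantile_def cdf_def)
      with sub(1)[of q q'] show ?thesis by linarith
    next
      case False
      with q have "0 \<le> (measure M {..<q} - \<tau>) * (q' - q)"
        by (auto simp: is_quantile_def intro: mult_nonpos_nonpos)
      with sub(2)[of q q'] show ?thesis by linarith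
    qed
  qed
next
  assume min: "\<forall>q'. quantile_objective \<tau> M q \<le> quantile_objective \<tau> M q'"
  \<comment> \<open>The subgradient inequality at \<open>q'\<close>, evaluated at the minimizer,
    puts \<open>cdf M q'\<close> at or above \<open>\<tau>\<close> for \<open>q' > q\<close> and at
    or below it for \<open>q' < q\<close>. Right continuity and the left limit
    \<open>measure M {..<q}\<close> carry these bounds to \<open>q\<close>.\<close>
  have slope: "(cdf M q' - \<tau>) * (q - q') \<le> 0" for q'
    using quantile_objective_subgradient(1)[OF assms, of q' q] min[rule_format, of q'] by linarith
  have "\<tau> \<le> cdf M q"
  proof (rule ccontr)
    assume "\<not> \<tau> \<le> cdf M q"
    moreover have "(cdf M \<longlongrightarrow> cdf M q) (at_right q)"
      using cdf_is_right_cont by (simp add: continuous_within)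
    ultimately have "\<forall>\<^sub>F x in at_right q. cdf M x < \<tau>"
      by (intro order_tendstoD(2)) auto
    then have "\<forall>\<^sub>F x in at_right q. cdf M x < \<tau> \<and> q < x"
      by (intro eventually_conj eventually_at_right_less)
    then obtain q' where "q < q'" "cdf M q' < \<tau>"
      using eventually_happens'[OF trivial_limit_at_right_real] by blast
    then show False
      using slope[of q'] mult_neg_neg[of "cdf M q' - \<tau>" "q - q'"] by linarith
  qed
  moreover have "measure M {..<q} \<le> \<tau>"
  proof (rule ccontr)
    assume "\<not> measure M {..<q} \<le> \<tau>"
    then have "\<forall>\<^sub>F x in at_left q. \<tau> < cdf M x"
      by (intro order_tendstoD(1)[OF cdf_at_left]) auto
    then have "\<forall>\<^sub>F x in at_left q. \<tau> < cdf M x \<and> x < q"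
      by (intro eventually_conj) (auto simp: eventually_at_filter)
    then obtain q' where "q' < q" "\<tau> < cdf M q'"
      using eventually_happens'[OF trivial_limit_at_left_real] by blast
    then show False
      using slope[of q'] mult_pos_pos[of "cdf M q' - \<tau>" "q - q'"] by linarith
  qed
  ultimately show "is_quantile \<tau> M q"
    by (simp add: is_quantile_def cdf_def)
qed

text \<open>The objective vanishes at 0, so the two cases are its increments from 0 to
  \<open>q\<close> and from \<open>q\<close> to 0.\<close>

lemma quantile_objective_eq:
  assumes "0 < \<tau>" "\<tau> < 1"
  shows "quantile_objective \<tau> M q =
            (if q \<ge> 0 then - \<tau> * q + (LINT x:{0<..q}|lborel. cdf M x)
             else - \<tau> * q - (LINT x:{q<..0}|lborel. cdf M x))"
  using quantile_objective_increment[OF assms, of 0 q] quantile_objective_increment[OF assms, of q 0]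
  by auto

end

text \<open>The endpoint \<open>a\<close> is a null set. This reconciles the closed intervals of
  \<open>primitive_at_0\<close> with the half-open ones of the increment formula.\<close>

lemma set_lebesgue_integral_lborel_Icc_eq_Ioc:
  fixes f :: "real \<Rightarrow> real"
  assumes [measurable]: "f \<in> borel_measurable borel"
  shows "(LINT u:{a..b}|lborel. f u) = (LINT u:{a<..b}|lborel. f u)"
proof (rule set_integral_cong_set)
  show "AE u in lborel. u \<in> {a<..b} \<longleftrightarrow> u \<in> {a..b}"
    using AE_lborel_singleton[of a] by eventually_elim auto
qed (auto simp: set_borel_measurable_def)

theorem theorem1:
  fixes \<tau> :: real and P :: "real measure"
  assumes "0 < \<tau>" and "\<tau> < 1" and "real_distribution P"
  shows "(\<forall>q. quantile_objective \<tau> P q =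
            (if q \<ge> 0 then - \<tau> * q + (LINT x:{0<..q}|lborel. cdf P x)
             else - \<tau> * q - (LINT x:{q<..0}|lborel. cdf P x)))
       \<and> (\<forall>q. quantile_objective \<tau> P q = primitive_at_0 (cdf P) q - \<tau> * q)
       \<and> convex_on UNIV (quantile_objective \<tau> P)
       \<and> inf_compact (quantile_objective \<tau> P)
       \<and> (\<forall>q. is_quantile \<tau> P q \<longleftrightarrow>
            (\<forall>q'. quantile_objective \<tau> P q \<le> quantile_objective \<tau> P q'))"
proof -
  interpret real_distribution P by fact
  have cdf_measurable: "cdf P \<in> borel_measurable borel"
    by (rule borel_measurable_mono) (simp add: mono_def cdf_nondecreasing)
  note formula = quantile_objective_eq[OF assms(1,2)]
  have "quantile_objective \<tau> P q = primitive_at_0 (cdf P) q - \<tau> * q" for q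
    by (simp add: formula primitive_at_0_def set_lebesgue_integral_lborel_Icc_eq_Ioc cdf_measurable)
  then show ?thesis
    using formula convex_on_quantile_objective[OF assms(1,2)]
      inf_compact_quantile_objective[OF assms(1,2)] is_quantile_iff_minimizer[OF assms(1,2)]
    by blast
qed

end
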